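(* Let $k\ge1$ and $n=2k+2$. For any choice of points $q_1,\dots,q_{2k+2}\in\mathbb{R}^2$ in convex position, the rows of the cofactor matrix $C_{2k}(q_1,\dots,q_{2k+2})$ realize $\overline{\Delta}_k(2k+2)$ as a polytopal fan.
   Context: An edge is an element of $\binom{[n]}{2}$. Two disjoint edges $\{i,j\},\{a,b\}$ with $i<j$, $a<b$ cross if $i<a<j<b$ or $a<i<b<j$. The length of $\{i,j\}$ is $\min\{|j-i|,n-|j-i|\}$. $\overline{\Delta}_k(n)$ is the simplicial complex whose vertices are the edges of length at least $k+1$ and whose faces are the sets of such edges containing no $k+1$ pairwise crossing edges; it is a sphere of dimension $k(n-2k-1)-1$. Convex position: $q_1,\dots,q_n$ are the distinct vertices of a convex $n$-gon, in this cyclic order. $C_d(\mathbf q)$ has one row per edge $\{i,j\}$, $i<j$, and one block of $d$ columns per vertex; with $q_i=(x_i,y_i)$, the row of $\{i,j\}$ has $\mathbf c_{ij}$ in block $i$, $-\mathbf c_{ij}$ in block $j$, zeros elsewhere, where $\mathbf c_{ij}=\big((x_i-x_j)^{d-1},(y_i-y_j)(x_i-x_j)^{d-2},\dots,(y_i-y_j)^{d-1}\big)$. Realizing as a fan: let $(v_e)_{e\in\binom{[n]}{2}}$ be vectors, $W$ their linear span, $W'$ the quotient of $W$ by the span of the $v_e$ with $e$ of length at most $k$, and $\bar v_e$ the image of $v_e$ in $W'$. The vectors realize $\overline{\Delta}_k(n)$ as a complete fan if $\dim W'=k(n-2k-1)$ and the cones $\operatorname{cone}(\bar v_e:e\in F)$,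 $F\in\overline{\Delta}_k(n)$, form a complete simplicial fan in $W'$ (for each face $F$ the vectors $\{\bar v_e\}_{e\in F}$ are linearly independent; cones of faces $F,G$ intersect exactly in the cone of $F\cap G$; the cones cover $W'$). They realize it as a polytopal fan if, moreover, this fan is the normal fan of a polytope. *)

theory Defs
  imports "HOL-Analysis.Analysis" "HOL-Library.Function_Algebras" "HOL-Library.Ramsey"
begin

text \<open>Real-valued functions on any index set form a real vector space under the pointwise
  operations (addition is provided by \<^theory>\<open>HOL-Library.Function_Algebras\<close>). This is used for the
  rows of matrices, indexed by their columns, and for spaces of linear functionals.\<close>

instantiation "fun" :: (type, real_vector) real_vector
begin

definition scaleR_fun :: "real \<Rightarrow> ('a \<Rightarrow> 'b) \<Rightarrow> 'a \<Rightarrow> 'b"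
  where "scaleR_fun c f = (\<lambda>x. c *\<^sub>R f x)"

instance
  by standard (auto simp: scaleR_fun_def fun_eq_iff algebra_simps)

end

definition edges :: "nat \<Rightarrow> nat set set"
  where "edges n = nsets {1..n} 2"

definition cross :: "nat set \<Rightarrow> nat set \<Rightarrow> bool"
  where "cross e f \<longleftrightarrow> (\<exists>i j a b. e = {i, j} \<and> f = {a, b} \<and> i < j \<and> a < b \<and>
           (i < a \<and> a < j \<and> j < b \<or> a < i \<and> i < b \<and> b < j))"

definition edge_length :: "nat \<Rightarrow> nat set \<Rightarrow> nat"
  where "edge_length n e = min (Max e - Min e) (n - (Max e - Min e))"

text \<open>The set of faces of $\overline{\Delta}_k(n)$, the empty face included.\<close>

definition reduced_multiassociahedron :: "nat \<Rightarrow> nat \<Rightarrow> nat set set set"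
  where "reduced_multiassociahedron k n =
    {F. F \<subseteq> {e \<in> edges n. k + 1 \<le> edge_length n e} \<and>
        \<not> (\<exists>S \<subseteq> F. card S = k + 1 \<and> pairwise cross S)}"

text \<open>The points \<open>q 1, \<dots>, q n\<close> are the distinct vertices of their convex hull, and
  cyclically consecutive ones span its edges. Both orientations are allowed.\<close>

definition convex_position :: "nat \<Rightarrow> (nat \<Rightarrow> real \<times> real) \<Rightarrow> bool"
  where "convex_position n q \<longleftrightarrow>
    inj_on q {1..n} \<and>
    {p. p extreme_point_of (convex hull (q ` {1..n}))} = q ` {1..n} \<and>
    (\<forall>i \<in> {1..n}. closed_segment (q i) (q (if i = n then 1 else i + 1))
                   edge_of (convex hull (q ` {1..n})))"

text \<open>Entry \<open>t\<close> (\<open>0 \<le> t < d\<close>) of the vector $\mathbf c_{ij}$.\<close>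

definition cofactor_entry :: "nat \<Rightarrow> (nat \<Rightarrow> real \<times> real) \<Rightarrow> nat \<Rightarrow> nat \<Rightarrow> nat \<Rightarrow> real"
  where "cofactor_entry d q i j t =
    (snd (q i) - snd (q j)) ^ t * (fst (q i) - fst (q j)) ^ (d - 1 - t)"

text \<open>\<open>cofactor_matrix d q e\<close> is the row of the edge \<open>e\<close>. Its entry at \<open>(v, t)\<close> with \<open>t < d\<close> is in
  column \<open>t\<close> of the block of vertex \<open>v\<close>; it is extended by zero to all other index pairs.\<close>

definition cofactor_matrix :: "nat \<Rightarrow> (nat \<Rightarrow> real \<times> real) \<Rightarrow> nat set \<Rightarrow> nat \<times> nat \<Rightarrow> real"
  where "cofactor_matrix d q e = (\<lambda>(v, t).
    if d \<le> t then 0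
    else if v = Min e then cofactor_entry d q (Min e) (Max e) t
    else if v = Max e then - cofactor_entry d q (Min e) (Max e) t
    else 0)"

text \<open>\<open>p\<close> restricts to a linear map on \<open>W\<close> with kernel \<open>L\<close>, so that \<open>p ` W\<close> is the quotient \<open>W / L\<close>
  and \<open>p w\<close> the class of \<open>w\<close>. Every subspace of the ambient space has a complement, so such a
  map exists already with values in the ambient space.\<close>

definition quotient_map_by :: "('a::real_vector \<Rightarrow> 'b::real_vector) \<Rightarrow> 'a set \<Rightarrow> 'a set \<Rightarrow> bool"
  where "quotient_map_by p W L \<longleftrightarrow> linear p \<and> {w \<in> W. p w = 0} = L"

lemma quotient_map_by_exists:
  fixes W L :: "'a::real_vector set"
  assumes "subspace L" "L \<subseteq> W"
  shows "\<exists>p :: 'a \<Rightarrow> 'a. quotient_map_by p W L"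
proof -
  obtain g :: "'a \<Rightarrow> 'a" where g: "range g \<subseteq> L" "linear g" "\<forall>v\<in>L. g v = v"
    using linear_exists_left_inverse_on[of "\<lambda>x::'a. x" L] assms(1) linear_id
    by (auto simp: inj_on_def id_def)
  have "linear (\<lambda>x. x - g x)"
    using g(2) linear_id linear_compose_sub[of "\<lambda>x. x" g] by (simp add: id_def)
  moreover have "{w \<in> W. w - g w = 0} = L"
    using g assms(2) by auto
  ultimately show ?thesis
    unfolding quotient_map_by_def by blast
qed

definition complete_simplicial_fan :: "'e set set \<Rightarrow> ('e \<Rightarrow> 'a::real_vector) \<Rightarrow> 'a set \<Rightarrow> bool"
  where "complete_simplicial_fan \<Delta> u W \<longleftrightarrow>
    (\<forall>F\<in>\<Delta>. inj_on u F \<and> independent (u ` F)) \<and>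
    (\<forall>F\<in>\<Delta>. \<forall>G\<in>\<Delta>. convex_cone hull (u ` F) \<inter> convex_cone hull (u ` G)
                     = convex_cone hull (u ` (F \<inter> G))) \<and>
    (\<Union>F\<in>\<Delta>. convex_cone hull (u ` F)) = W"

text \<open>The normal fan, in the subspace \<open>W\<close> of \<open>'a\<close>, of a polytope \<open>P\<close> in the dual space of \<open>W\<close>:
  its cones consist of the vectors that, as functions on \<open>P\<close>, are maximal on a given nonempty face.
  Elements of the dual of \<open>W\<close> are represented by linear functionals on \<open>'a\<close>; the resulting
  set of cones depends only on their restrictions to \<open>W\<close>.\<close>

definition normal_fan :: "'a::real_vector set \<Rightarrow> ('a \<Rightarrow> real) set \<Rightarrow> 'a set set"
  where "normal_fan W P =
    {{x \<in> W. \<forall>f\<in>G. \<forall>g\<in>P. g x \<le> f x} | G. G face_of P \<and> G \<noteq> {}}"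

text \<open>In the following two definitions the quotient of the span \<open>W\<close> of all the vectors by the span
  of those with index of length at most \<open>k\<close> is \<open>p ` W\<close>, for an arbitrary quotient map \<open>p\<close>; all the
  conditions are invariant under linear isomorphisms of the quotient, and by
  \<open>quotient_map_by_exists\<close> the quantification over \<open>p\<close> is not vacuous.\<close>

definition realizes_complete_fan :: "nat \<Rightarrow> nat \<Rightarrow> (nat set \<Rightarrow> 'a::real_vector) \<Rightarrow> bool"
  where "realizes_complete_fan k n v \<longleftrightarrow>
    (\<forall>p :: 'a \<Rightarrow> 'a.
       quotient_map_by p (span (v ` edges n)) (span (v ` {e \<in> edges n. edge_length n e \<le> k})) \<longrightarrow>
       dim (p ` span (v ` edges n)) = k * (n - 2 * k - 1) \<and>
       complete_simplicial_fan (reduced_multiassociahedron k n) (p \<circ> v) (p ` span (v ` edges n)))"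

definition realizes_polytopal_fan :: "nat \<Rightarrow> nat \<Rightarrow> (nat set \<Rightarrow> 'a::real_vector) \<Rightarrow> bool"
  where "realizes_polytopal_fan k n v \<longleftrightarrow>
    realizes_complete_fan k n v \<and>
    (\<forall>p :: 'a \<Rightarrow> 'a.
       quotient_map_by p (span (v ` edges n)) (span (v ` {e \<in> edges n. edge_length n e \<le> k})) \<longrightarrow>
       (\<exists>P. polytope P \<and> P \<subseteq> {f. linear f} \<and>
            (\<lambda>F. convex_cone hull ((p \<circ> v) ` F)) ` reduced_multiassociahedron k n
              = normal_fan (p ` span (v ` edges n)) P))"

end

theory Submission
  imports Defs
begin

text \<open>
  For \<open>n = 2k + 2\<close> the edges of length at least \<open>k + 1\<close> are the \<open>k + 1\<close> diameters
  \<open>{i, i + k + 1}\<close>, and any two of them cross. The complex is therefore the boundary of the simplex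
  on the diameters, and its realization as a complete fan in dimension \<open>k\<close> amounts to \<open>k + 1\<close>
  vectors with exactly one linear relation up to scale, all of whose coefficients are positive. Such
  a fan is the normal fan of a simplex (\<open>complete_simplicial_fan_boundary\<close>,
  \<open>boundary_fan_eq_normal_fan\<close>).

  The relation comes from a relation among all rows of the cofactor matrix. As \<open>d = 2k\<close> is even, the
  block of a vertex \<open>i\<close> in the row of \<open>{i, j}\<close> lists the monomials of degree \<open>d - 1\<close> at the vector
  \<open>q i - q j\<close>, whichever of \<open>i, j\<close> is larger. So the coefficients \<open>c {i, j}\<close> form a relation iff, for
  each vertex \<open>i\<close>, they form a relation among the Veronese images of the \<open>d + 1\<close> vectors
  \<open>q i - q j\<close>. Since no two of these vectors are parallel, the latter relation is unique up to a
  factor: by Lagrange interpolation, the coefficient at \<open>j\<close> is the inverse of the product over the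
  other \<open>l\<close> of the determinants \<open>det (q i - q j, q i - q l)\<close> (\<open>monomial_relation\<close>,
  \<open>monomial_relation_unique\<close>). That determinant is the orientation of the triple \<open>(i, j, l)\<close>.
  Exchanging \<open>i\<close> and \<open>j\<close> changes the sign of all \<open>2k\<close> factors, hence the product is a function of
  the edge, the local relations glue to a global one, and uniqueness is inherited
  (\<open>cofactor_relation\<close>, \<open>cofactor_relation_unique\<close>).

  A diameter has \<open>k\<close> of the remaining points on each side, so its coefficient has the sign
  \<open>(-1) ^ k\<close>, the same for all diameters (\<open>edge_turns_diameter\<close>). Passing to the quotient by the
  short edges leaves the relation among the diameters, now with coefficients of a single sign.
\<close>

section \<open>Finite combinations and faces of convex hulls\<close>

lemma span_image_sum:
  fixes u :: "'i \<Rightarrow> 'a::real_vector"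
  assumes "finite S" "x \<in> span (u ` S)"
  obtains c where "x = (\<Sum>i\<in>S. c i *\<^sub>R u i)"
proof -
  let ?R = "range (\<lambda>c. \<Sum>i\<in>S. c i *\<^sub>R u i)"
  have "subspace ?R"
    unfolding subspace_def
  proof (intro conjI ballI allI)
    show "0 \<in> ?R" by (rule range_eqI[of _ _ "\<lambda>_. 0"]) simp
    fix x y assume "x \<in> ?R" "y \<in> ?R"
    then obtain c d where "x = (\<Sum>i\<in>S. c i *\<^sub>R u i)" "y = (\<Sum>i\<in>S. d i *\<^sub>R u i)" by blast
    then show "x + y \<in> ?R"
      by (intro range_eqI[of _ _ "\<lambda>i. c i + d i"]) (simp add: sum.distrib scaleR_add_left)
  next
    fix r x assume "x \<in> ?R"
    then obtain c where "x = (\<Sum>i\<in>S. c i *\<^sub>R u i)" by blast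
    then show "r *\<^sub>R x \<in> ?R"
      by (intro range_eqI[of _ _ "\<lambda>i. r * c i"]) (simp add: scaleR_sum_right)
  qed
  moreover have "u ` S \<subseteq> ?R"
  proof safe
    fix i assume "i \<in> S"
    then show "u i \<in> ?R"
      by (intro range_eqI[of _ _ "\<lambda>j. if j = i then 1 else 0"])
         (simp add: assms(1) if_distrib[of "\<lambda>r. r *\<^sub>R _"] cong: if_cong)
  qed
  ultimately have "span (u ` S) \<subseteq> ?R" by (simp add: span_minimal)
  with assms(2) show ?thesis using that by blast
qed

lemma convex_cone_hull_sum:
  assumes "finite F" "\<And>i. i \<in> F \<Longrightarrow> 0 \<le> c i"
  shows "(\<Sum>i\<in>F. c i *\<^sub>R u i) \<in> convex_cone hull (u ` F)"
proof -
  have "(\<Sum>i\<in>F'. c i *\<^sub>R u i) \<in> convex_cone hull (u ` F)" if "F' \<subseteq> F" for F'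
    using finite_subset[OF that assms(1)] that
  proof (induction F' rule: finite_induct)
    case empty
    show ?case by (simp add: convex_cone_hull_contains_0)
  next
    case (insert i F')
    then have "c i *\<^sub>R u i \<in> convex_cone hull (u ` F)"
      by (intro convex_cone_hull_mul hull_inc) (auto simp: assms(2))
    with insert show ?case by (auto intro: convex_cone_hull_add)
  qed
  then show ?thesis by blast
qed

text \<open>If a point of a face is a convex combination of points of \<open>V\<close>, then each \<open>v\<close> of nonzero weight lies
  in the face: unless the point is \<open>v\<close> itself, it lies on the open segment from \<open>v\<close> to the normalized
  combination of the others. The polytope below consists of functionals, so the argument is
  needed in an arbitrary real vector space.\<close>

lemma face_of_convex_hull_finite:
  fixes V :: "'a::real_vector set"
  assumes "finite V" and G: "G face_of (convex hull V)"
  shows "G = convex hull (G \<inter> V)"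
proof
  show "convex hull (G \<inter> V) \<subseteq> G"
    using G by (simp add: face_of_imp_convex hull_minimal)
  show "G \<subseteq> convex hull (G \<inter> V)"
  proof
    fix x assume x: "x \<in> G"
    then have "x \<in> convex hull V" using G face_of_imp_subset by blast
    then obtain c where c: "\<And>v. v \<in> V \<Longrightarrow> 0 \<le> c v" "sum c V = 1" "x = (\<Sum>v\<in>V. c v *\<^sub>R v)"
      using convex_hull_finite[OF assms(1)] by auto
    have inG: "v \<in> G" if v: "v \<in> V" "c v \<noteq> 0" for v
    proof (cases "c v = 1")
      case True
      have "c w = 0" if "w \<in> V - {v}" for w
      proof -
        have "sum c (V - {v}) = 0"
          using c(2) True v assms(1) by (simp add: sum_diff1)
        then show ?thesis
          using that c(1) assms(1) sum_nonneg_eq_0_iff[of "V - {v}" c] by auto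
      qed
      then have "x = v"
        using c(3) True v assms(1) by (simp add: sum.remove[of V v])
      with x show ?thesis by simp
    next
      case False
      have s: "sum c (V - {v}) = 1 - c v"
        using c(2) v assms(1) by (simp add: sum_diff1)
      have "0 \<le> sum c (V - {v})" by (intro sum_nonneg) (auto intro: c(1))
      with s False have lt: "c v < 1" by simp
      have pos: "c v > 0" using v c(1)[of v] by simp
      define y where "y = (\<Sum>w\<in>V - {v}. (c w / (1 - c v)) *\<^sub>R w)"
      have "y \<in> convex hull V" unfolding y_def
      proof (rule convex_sum)
        show "(\<Sum>w\<in>V - {v}. c w / (1 - c v)) = 1"
          using s lt by (simp add: sum_divide_distrib[symmetric])
      qed (use assms(1) c(1) lt in \<open>auto intro: hull_inc\<close>)
      have "(1 - c v) *\<^sub>R y = (\<Sum>w\<in>V - {v}. c w *\<^sub>R w)"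
        using lt by (simp add: y_def scaleR_sum_right)
      then have xy: "x = c v *\<^sub>R v + (1 - c v) *\<^sub>R y"
        using c(3) v assms(1) by (simp add: sum.remove[of V v])
      show ?thesis
      proof (cases "v = y")
        case True
        then have "x = v" using xy by (simp add: scaleR_left_distrib[symmetric])
        with x show ?thesis by simp
      next
        case False
        then have "x \<in> open_segment v y"
          unfolding in_segment using xy lt pos
          by (intro conjI exI[of _ "1 - c v"]) auto
        moreover have "v \<in> convex hull V" using v by (simp add: hull_inc)
        ultimately show ?thesis
          using G x \<open>y \<in> convex hull V\<close> unfolding face_of_def by blast
      qed
    qed
    have "x = (\<Sum>v\<in>G \<inter> V. c v *\<^sub>R v)"
      unfolding c(3) using assms(1) inG by (intro sum.mono_neutral_right) auto
    moreover have "sum c (G \<inter> V) = 1"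
      unfolding c(2)[symmetric] using assms(1) inG by (intro sum.mono_neutral_left) auto
    ultimately show "x \<in> convex hull (G \<inter> V)"
      using assms(1) c(1) by (auto intro!: convex_sum intro: hull_inc)
  qed
qed

section \<open>The fan of a positive circuit\<close>

text \<open>A family of vectors whose only linear relation, up to a factor, is positive: the rays of a complete
  fan with one ray more than its dimension.\<close>

locale positive_circuit =
  fixes D :: "'i set" and u :: "'i \<Rightarrow> 'a::real_vector" and lam :: "'i \<Rightarrow> real"
  assumes finite_D: "finite D" and D_nonempty: "D \<noteq> {}"
    and lam_pos: "i \<in> D \<Longrightarrow> 0 < lam i"
    and relation: "(\<Sum>i\<in>D. lam i *\<^sub>R u i) = 0"
    and relation_unique: "(\<Sum>i\<in>D. c i *\<^sub>R u i) = 0 \<Longrightarrow> \<exists>s. \<forall>i\<in>D. c i = s * lam i"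
begin

text \<open>A relation on a proper subset extends by zero to a multiple of \<open>lam\<close> that vanishes at some index,
  where \<open>lam\<close> does not; the multiple is zero.\<close>

lemma relation_on_proper_subset:
  assumes F: "F \<subset> D" and c: "(\<Sum>i\<in>F. c i *\<^sub>R u i) = 0" and i: "i \<in> F"
  shows "c i = 0"
proof -
  define d where "d i = (if i \<in> F then c i else 0)" for i
  have "(\<Sum>i\<in>D. d i *\<^sub>R u i) = (\<Sum>i\<in>F. c i *\<^sub>R u i)"
    using F finite_D by (intro sum.mono_neutral_cong_right) (auto simp: d_def)
  with c obtain s where s: "\<And>i. i \<in> D \<Longrightarrow> d i = s * lam i"
    using relation_unique[of d] by auto
  obtain j where j: "j \<in> D" "j \<notin> F" using F by blast
  then have "s = 0" using s[of j] lam_pos[of j] by (simp add: d_def)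
  then show ?thesis using s[of i] i F by (auto simp: d_def)
qed

lemma proper_subset_independent:
  assumes F: "F \<subset> D"
  shows "inj_on u F" "independent (u ` F)"
proof -
  have fin: "finite F" using F finite_D finite_subset by blast
  show inj: "inj_on u F"
  proof (rule inj_onI, rule ccontr)
    fix i j assume ij: "i \<in> F" "j \<in> F" "u i = u j" "i \<noteq> j"
    have "(\<Sum>l\<in>F. (of_bool (l = i) - of_bool (l = j)) *\<^sub>R u l)
        = (\<Sum>l\<in>F. if l = i then u l else 0) - (\<Sum>l\<in>F. if l = j then u l else 0)"
      unfolding sum_subtractf[symmetric] by (intro sum.cong) auto
    also have "\<dots> = 0" using fin ij by simp
    finally have "of_bool (i = i) - of_bool (i = j) = (0::real)"
      using ij by (intro relation_on_proper_subset[OF F])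
    with ij show False by simp
  qed
  show "independent (u ` F)"
  proof
    assume "dependent (u ` F)"
    then obtain c v where "(\<Sum>v\<in>u ` F. c v *\<^sub>R v) = 0" and v: "v \<in> u ` F" "c v \<noteq> 0"
      using fin by (auto simp: dependent_finite)
    then have "(\<Sum>i\<in>F. (c \<circ> u) i *\<^sub>R u i) = 0"
      by (simp add: sum.reindex[OF inj])
    with v show False using relation_on_proper_subset[OF F] by fastforce
  qed
qed

lemma span_drop_one:
  assumes "j \<in> D"
  shows "span (u ` (D - {j})) = span (u ` D)"
proof (rule span_eq[THEN iffD2], intro conjI)
  have "u j = (\<Sum>i\<in>D - {j}. (- lam i / lam j) *\<^sub>R u i)"
  proof -
    have "lam j *\<^sub>R u j + (\<Sum>i\<in>D - {j}. lam i *\<^sub>R u i) = 0"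
      using relation sum.remove[OF finite_D assms, of "\<lambda>i. lam i *\<^sub>R u i"] by simp
    then have "lam j *\<^sub>R u j = - (\<Sum>i\<in>D - {j}. lam i *\<^sub>R u i)"
      by (simp add: add_eq_0_iff2)
    then have "(1 / lam j) *\<^sub>R (lam j *\<^sub>R u j) = (1 / lam j) *\<^sub>R (- (\<Sum>i\<in>D - {j}. lam i *\<^sub>R u i))"
      by simp
    then show ?thesis
      using lam_pos[OF assms] by (simp add: scaleR_sum_right sum_negf)
  qed
  also have "\<dots> \<in> span (u ` (D - {j}))"
    by (intro span_sum span_scale span_base) auto
  finally show "u ` D \<subseteq> span (u ` (D - {j}))"
    by (auto intro: span_base)
qed (auto intro: span_base)

lemma dim_span_circuit: "dim (span (u ` D)) = card D - 1"
proof -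
  obtain j where j: "j \<in> D" using D_nonempty by blast
  have F: "D - {j} \<subset> D" using j by blast
  have "dim (span (u ` D)) = card (u ` (D - {j}))"
    using proper_subset_independent(2)[OF F]
    by (rule real_vector.dim_eq_card[rotated]) (simp only: span_drop_one[OF j] span_span)
  also have "\<dots> = card D - 1"
    using card_image[OF proper_subset_independent(1)[OF F]] j finite_D by simp
  finally show ?thesis .
qed

text \<open>Writing \<open>x\<close> as the sum of the \<open>t m * lam m\<close> multiples of \<open>u m\<close>, the numbers \<open>t m\<close> are determined up
  to a common additive constant. Normalizing \<open>t z = 0\<close> for a fixed \<open>z\<close> makes each of them a linear
  functional on the span, and \<open>g m\<close> is minus that functional. Only differences of the \<open>g m\<close> are
  independent of \<open>z\<close>, so the specification mentions only these.\<close>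

lemma support_functionals_exist:
  "\<exists>g :: 'i \<Rightarrow> 'a \<Rightarrow> real. (\<forall>j. linear (g j)) \<and>
     (\<forall>i\<in>D. \<forall>j\<in>D. \<forall>m\<in>D. lam m * (g i (u m) - g j (u m)) = of_bool (m = j) - of_bool (m = i))"
proof -
  obtain z where z: "z \<in> D" using D_nonempty by blast
  have F: "D - {z} \<subset> D" using z by blast
  note inj = proper_subset_independent(1)[OF F]
  have "\<exists>h :: 'a \<Rightarrow> real. linear h \<and>
      (\<forall>m\<in>D. lam m * h (u m) = of_bool (m = z) - of_bool (m = i))" if i: "i \<in> D" for i
  proof (cases "i = z")
    case True
    then show ?thesis by (intro exI[of _ "\<lambda>_. 0"]) (simp add: linear_zero)
  next
    case False
    obtain h :: "'a \<Rightarrow> real" where h: "linear h"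
      "\<And>x. x \<in> u ` (D - {z}) \<Longrightarrow> h x = (if x = u i then - (1 / lam i) else 0)"
      using linear_independent_extend[OF proper_subset_independent(2)[OF F],
          of "\<lambda>x. if x = u i then - (1 / lam i) else 0 :: real"] by blast
    have hu: "lam m * h (u m) = - of_bool (m = i)" if "m \<in> D - {z}" for m
      using h(2)[of "u m"] that inj_on_eq_iff[OF inj that, of i] i False lam_pos[of m] by auto
    have "0 = h (\<Sum>m\<in>D. lam m *\<^sub>R u m)"
      using relation linear_0[OF h(1)] by simp
    also have "\<dots> = (\<Sum>m\<in>D. lam m * h (u m))"
      by (simp add: linear_sum[OF h(1)] linear_cmul[OF h(1)])
    also have "\<dots> = lam z * h (u z) + (\<Sum>m\<in>D - {z}. - of_bool (m = i))"
      using z finite_D hu by (simp add: sum.remove[of D z])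
    also have "(\<Sum>m\<in>D - {z}. - of_bool (m = i)) = (\<Sum>m\<in>D - {z}. if m = i then - 1 else 0 :: real)"
      by (intro sum.cong) auto
    also have "\<dots> = - 1" using i False finite_D by simp
    \<comment> \<open>The value at \<open>u z\<close> is forced by the relation, as the \<open>u m\<close> with \<open>m \<noteq> z\<close> form a basis.\<close>
    finally have "lam z * h (u z) = 1" by simp
    with h(1) hu False show ?thesis by (intro exI[of _ h]) (auto simp: of_bool_def)
  qed
  then obtain g where g: "\<And>i. i \<in> D \<Longrightarrow> linear (g i :: 'a \<Rightarrow> real)"
    "\<And>i m. i \<in> D \<Longrightarrow> m \<in> D \<Longrightarrow> lam m * g i (u m) = of_bool (m = z) - of_bool (m = i)"
    by metis
  show ?thesis
    by (rule exI[of _ "\<lambda>i. if i \<in> D then g i else (\<lambda>_. 0)"])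
       (auto simp: g right_diff_distrib linear_zero)
qed

definition support :: "'i \<Rightarrow> 'a \<Rightarrow> real"
  where "support = (SOME g. (\<forall>j. linear (g j)) \<and>
     (\<forall>i\<in>D. \<forall>j\<in>D. \<forall>m\<in>D. lam m * (g i (u m) - g j (u m)) = of_bool (m = j) - of_bool (m = i)))"

lemma linear_support: "linear (support j)"
  and support_diff: "i \<in> D \<Longrightarrow> j \<in> D \<Longrightarrow> m \<in> D \<Longrightarrow>
    lam m * (support i (u m) - support j (u m)) = of_bool (m = j) - of_bool (m = i)"
  using someI_ex[OF support_functionals_exist] unfolding support_def[symmetric] by auto

lemma support_diff_combination:
  assumes "i \<in> D" "j \<in> D"
  shows "support i (\<Sum>m\<in>D. (t m * lam m) *\<^sub>R u m) - support j (\<Sum>m\<in>D. (t m * lam m) *\<^sub>R u m) = t j - t i"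
proof -
  have "support i (\<Sum>m\<in>D. (t m * lam m) *\<^sub>R u m) - support j (\<Sum>m\<in>D. (t m * lam m) *\<^sub>R u m)
      = (\<Sum>m\<in>D. t m * (lam m * (support i (u m) - support j (u m))))"
    by (simp add: linear_sum[OF linear_support] linear_cmul[OF linear_support] sum_subtractf[symmetric]
        algebra_simps)
  also have "\<dots> = (\<Sum>m\<in>D. t m * (of_bool (m = j) - of_bool (m = i)))"
    using assms by (simp add: support_diff)
  also have "\<dots> = (\<Sum>m\<in>D. if m = j then t m else 0) - (\<Sum>m\<in>D. if m = i then t m else 0)"
    unfolding sum_subtractf[symmetric] by (intro sum.cong) auto
  also have "\<dots> = t j - t i" using assms finite_D by simp
  finally show ?thesis .
qed

lemma span_combination:
  assumes "x \<in> span (u ` D)"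
  obtains t where "x = (\<Sum>m\<in>D. (t m * lam m) *\<^sub>R u m)"
proof -
  obtain c where c: "x = (\<Sum>m\<in>D. c m *\<^sub>R u m)"
    using span_image_sum[OF finite_D assms] .
  have "x = (\<Sum>m\<in>D. (c m / lam m * lam m) *\<^sub>R u m)"
    unfolding c by (intro sum.cong refl) (use lam_pos in force)
  then show ?thesis using that[of "\<lambda>m. c m / lam m"] by simp
qed

text \<open>In terms of the coordinates \<open>t\<close> of \<open>x\<close>, both sides say that \<open>t\<close> attains its minimum at every index
  outside \<open>F\<close>: subtracting this minimum makes all coefficients nonnegative and zero off \<open>F\<close>. This
  description yields at once the intersections of cones, the covering property and the normal fan.\<close>

lemma cone_eq_max_region:
  assumes F: "F \<subset> D"
  shows "convex_cone hull (u ` F) = {x \<in> span (u ` D). \<forall>j\<in>D - F. \<forall>i\<in>D. support i x \<le> support j x}"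
    (is "_ = ?R")
proof
  have "u m \<in> ?R" if m: "m \<in> F" for m
  proof -
    have "support i (u m) \<le> support j (u m)" if "j \<in> D - F" "i \<in> D" for i j
    proof -
      have "lam m * (support i (u m) - support j (u m)) \<le> 0"
        using support_diff[of i j m] m that F by auto
      then show ?thesis using lam_pos[of m] m F by (auto simp: mult_le_0_iff)
    qed
    then show ?thesis using m F span_base[of "u m" "u ` D"] by blast
  qed
  moreover have "convex_cone ?R"
    unfolding convex_cone_iff
    by (auto simp: linear_0[OF linear_support] linear_add[OF linear_support] linear_cmul[OF linear_support]
        intro: span_add span_scale add_mono mult_left_mono span_zero)
  ultimately show "convex_cone hull (u ` F) \<subseteq> ?R"
    by (intro hull_minimal) auto
  show "?R \<subseteq> convex_cone hull (u ` F)"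
  proof
    fix x assume x: "x \<in> ?R"
    then obtain t where t: "x = (\<Sum>m\<in>D. (t m * lam m) *\<^sub>R u m)"
      using span_combination by blast
    obtain z where z: "z \<in> D - F" using F by blast
    have tz: "t z \<le> t i" if "i \<in> D" for i
      using support_diff_combination[OF that, of z t] x z that unfolding t[symmetric] by force
    have tz': "t i = t z" if "i \<in> D - F" for i
      using support_diff_combination[of z i t] x z that tz[of i] unfolding t[symmetric] by force
    have "x = x - t z *\<^sub>R (\<Sum>m\<in>D. lam m *\<^sub>R u m)" by (simp add: relation)
    also have "\<dots> = (\<Sum>m\<in>D. ((t m - t z) * lam m) *\<^sub>R u m)"
      unfolding t by (simp add: scaleR_sum_right sum_subtractf[symmetric] algebra_simps)
    also have "\<dots> = (\<Sum>m\<in>F. ((t m - t z) * lam m) *\<^sub>R u m)"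
      using F finite_D tz' by (intro sum.mono_neutral_right) auto
    also have "\<dots> \<in> convex_cone hull (u ` F)"
    proof (rule convex_cone_hull_sum)
      show "finite F" using F finite_D finite_subset by blast
      show "0 \<le> (t m - t z) * lam m" if "m \<in> F" for m
        using that F tz[of m] lam_pos[of m] by auto
    qed
    finally show "x \<in> convex_cone hull (u ` F)" .
  qed
qed

lemma exists_maximal_functional: "\<exists>j\<in>D. \<forall>i\<in>D. support i x \<le> support j x"
proof -
  have "Max ((\<lambda>i. support i x) ` D) \<in> (\<lambda>i. support i x) ` D"
    using finite_D D_nonempty by (intro Max_in) auto
  then obtain j where "j \<in> D" "Max ((\<lambda>i. support i x) ` D) = support j x" by auto
  then show ?thesis using finite_D by (metis Max_ge finite_imageI imageI)
qed

theorem complete_simplicial_fan_boundary: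
  "complete_simplicial_fan {F. F \<subset> D} u (span (u ` D))"
  unfolding complete_simplicial_fan_def
proof (intro conjI ballI)
  fix F G assume "F \<in> {F. F \<subset> D}" "G \<in> {F. F \<subset> D}"
  then have F: "F \<subset> D" and G: "G \<subset> D" and FG: "F \<inter> G \<subset> D" by auto
  show "inj_on u F" "independent (u ` F)" using proper_subset_independent[OF F] by auto
  show "convex_cone hull (u ` F) \<inter> convex_cone hull (u ` G) = convex_cone hull (u ` (F \<inter> G))"
    unfolding cone_eq_max_region[OF F] cone_eq_max_region[OF G] cone_eq_max_region[OF FG] by auto
next
  show "(\<Union>F\<in>{F. F \<subset> D}. convex_cone hull (u ` F)) = span (u ` D)"
  proof
    show "(\<Union>F\<in>{F. F \<subset> D}. convex_cone hull (u ` F)) \<subseteq> span (u ` D)"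
      using cone_eq_max_region by auto
    show "span (u ` D) \<subseteq> (\<Union>F\<in>{F. F \<subset> D}. convex_cone hull (u ` F))"
    proof
      fix x assume x: "x \<in> span (u ` D)"
      obtain j where j: "j \<in> D" "\<forall>i\<in>D. support i x \<le> support j x"
        using exists_maximal_functional by blast
      then have "D - {j} \<subset> D" by blast
      with cone_eq_max_region[OF this] x j
      show "x \<in> (\<Union>F\<in>{F. F \<subset> D}. convex_cone hull (u ` F))" by blast
    qed
  qed
qed

text \<open>A simplex: its vertices are the functionals \<open>support j\<close>, one for each \<open>j\<close> in \<open>D\<close>.\<close>

definition dual_polytope :: "('a \<Rightarrow> real) set"
  where "dual_polytope = convex hull (support ` D)"

lemma polytope_dual: "polytope dual_polytope"
  unfolding dual_polytope_def using finite_D by (simp add: polytope_convex_hull)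

lemma dual_polytope_linear: "dual_polytope \<subseteq> {f. linear f}"
  unfolding dual_polytope_def
proof (rule hull_minimal)
  show "support ` D \<subseteq> {f. linear f}" using linear_support by auto
  show "convex {f :: 'a \<Rightarrow> real. linear f}"
    unfolding convex_def plus_fun_def scaleR_fun_def real_scaleR_def[symmetric]
    by (auto simp del: real_scaleR_def intro!: linear_compose_add linear_compose_scale_right)
qed

lemma convex_value_le: "convex {f :: 'a \<Rightarrow> real. f x \<le> M}"
  and convex_value_ge: "convex {f :: 'a \<Rightarrow> real. M \<le> f x}"
proof -
  show "convex {f :: 'a \<Rightarrow> real. f x \<le> M}"
    unfolding convex_def by (auto simp: scaleR_fun_def intro: convex_bound_le)
  show "convex {f :: 'a \<Rightarrow> real. M \<le> f x}"
    unfolding convex_def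
  proof (clarsimp simp: scaleR_fun_def)
    fix f h :: "'a \<Rightarrow> real" and a b :: real
    assume "M \<le> f x" "M \<le> h x" "0 \<le> a" "0 \<le> b" "a + b = 1"
    then show "M \<le> a * f x + b * h x"
      using convex_bound_le[of "- f x" "- M" "- h x" a b] by simp
  qed
qed

text \<open>A face is the convex hull of the vertices it contains, so a vector is maximal on it iff it is maximal at
  these vertices; the latter is the description of a cone in \<open>cone_eq_max_region\<close>.\<close>

lemma normal_cone_of_face:
  assumes G: "G face_of dual_polytope" and ne: "G \<noteq> {}"
  shows "{j \<in> D. support j \<notin> G} \<subset> D"
    and "{x \<in> span (u ` D). \<forall>f\<in>G. \<forall>h\<in>dual_polytope. h x \<le> f x}
       = convex_cone hull (u ` {j \<in> D. support j \<notin> G})"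
proof -
  have hull: "G = convex hull (G \<inter> support ` D)"
    using face_of_convex_hull_finite[of "support ` D" G] G finite_D unfolding dual_polytope_def by simp
  with ne have "G \<inter> support ` D \<noteq> {}" by force
  then obtain z where z: "z \<in> D" "support z \<in> G" by auto
  then show sub: "{j \<in> D. support j \<notin> G} \<subset> D" by blast
  have "(\<forall>f\<in>G. \<forall>h\<in>dual_polytope. h x \<le> f x) \<longleftrightarrow> (\<forall>j\<in>D. support j \<in> G \<longrightarrow> (\<forall>i\<in>D. support i x \<le> support j x))"
    for x
  proof
    assume "\<forall>f\<in>G. \<forall>h\<in>dual_polytope. h x \<le> f x"
    then show "\<forall>j\<in>D. support j \<in> G \<longrightarrow> (\<forall>i\<in>D. support i x \<le> support j x)"
      unfolding dual_polytope_def by (auto intro: hull_inc)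
  next
    assume *: "\<forall>j\<in>D. support j \<in> G \<longrightarrow> (\<forall>i\<in>D. support i x \<le> support j x)"
    have "dual_polytope \<subseteq> {h. h x \<le> support z x}"
      unfolding dual_polytope_def using * z by (intro hull_minimal convex_value_le) auto
    moreover have "convex hull (G \<inter> support ` D) \<subseteq> {f. support z x \<le> f x}"
      using * z by (intro hull_minimal convex_value_ge) auto
    ultimately show "\<forall>f\<in>G. \<forall>h\<in>dual_polytope. h x \<le> f x"
      using hull by force
  qed
  then show "{x \<in> span (u ` D). \<forall>f\<in>G. \<forall>h\<in>dual_polytope. h x \<le> f x}
       = convex_cone hull (u ` {j \<in> D. support j \<notin> G})"
    unfolding cone_eq_max_region[OF sub] by auto
qed

lemma face_maximal_at:
  fixes P :: "('a \<Rightarrow> real) set"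
  assumes "convex P"
  shows "{f \<in> P. \<forall>h\<in>P. h x \<le> f x} face_of P"
  unfolding face_of_def
proof (intro conjI ballI impI)
  let ?G = "{f \<in> P. \<forall>h\<in>P. h x \<le> f x}"
  have "?G = P \<inter> (\<Inter>h\<in>P. {f. h x \<le> f x})" by auto
  then show "convex ?G"
    using assms by (auto intro!: convex_Int convex_INT convex_value_ge)
  fix a b f assume ab: "a \<in> P" "b \<in> P" and f: "f \<in> ?G" "f \<in> open_segment a b"
  then obtain s where s: "0 < s" "s < 1" "f = (1 - s) *\<^sub>R a + s *\<^sub>R b"
    unfolding in_segment by blast
  have fx: "f x = (1 - s) * a x + s * b x" using s(3) by (simp add: scaleR_fun_def)
  have le: "a x \<le> f x" "b x \<le> f x" using f ab by auto
  have "(1 - s) * (f x - a x) + s * (f x - b x) = 0" using fx by (simp add: algebra_simps)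
  moreover have "0 \<le> (1 - s) * (f x - a x)" "0 \<le> s * (f x - b x)" using le s by auto
  ultimately have "(1 - s) * (f x - a x) = 0" "s * (f x - b x) = 0" by linarith+
  then have "a x = f x" "b x = f x" using s by auto
  with f ab show "a \<in> ?G" "b \<in> ?G" by auto
qed auto

text \<open>The cone of \<open>F\<close> is the normal cone of the face of all functionals maximal at the sum of the
  \<open>lam m\<close> multiples of \<open>u m\<close> over \<open>m\<close> in \<open>F\<close>, because the vertices of this face are those with index
  outside \<open>F\<close>.\<close>

theorem boundary_fan_eq_normal_fan:
  "(\<lambda>F. convex_cone hull (u ` F)) ` {F. F \<subset> D} = normal_fan (span (u ` D)) dual_polytope"
proof (intro equalityI subsetI)
  fix C assume "C \<in> normal_fan (span (u ` D)) dual_polytope"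
  then obtain G where "G face_of dual_polytope" "G \<noteq> {}"
      "C = {x \<in> span (u ` D). \<forall>f\<in>G. \<forall>h\<in>dual_polytope. h x \<le> f x}"
    unfolding normal_fan_def by blast
  with normal_cone_of_face[of G]
  show "C \<in> (\<lambda>F. convex_cone hull (u ` F)) ` {F. F \<subset> D}" by auto
next
  fix C assume "C \<in> (\<lambda>F. convex_cone hull (u ` F)) ` {F. F \<subset> D}"
  then obtain F where F: "F \<subset> D" and C: "C = convex_cone hull (u ` F)" by blast
  define t where "t m = (of_bool (m \<in> F) :: real)" for m
  define x where "x = (\<Sum>m\<in>D. (t m * lam m) *\<^sub>R u m)"
  have support_x: "support i x - support j x = t j - t i" if "i \<in> D" "j \<in> D" for i j
    unfolding x_def using support_diff_combination[OF that] .
  define G where "G = {f \<in> dual_polytope. \<forall>h\<in>dual_polytope. h x \<le> f x}"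
  have face: "G face_of dual_polytope"
    unfolding G_def by (rule face_maximal_at) (simp add: dual_polytope_def convex_convex_hull)
  have support_in_G: "support j \<in> G \<longleftrightarrow> j \<notin> F" if j: "j \<in> D" for j
  proof
    assume "support j \<in> G"
    obtain z where z: "z \<in> D" "z \<notin> F" using F by blast
    have "support z \<in> dual_polytope" using z by (simp add: dual_polytope_def hull_inc)
    with \<open>support j \<in> G\<close> have "support z x \<le> support j x" by (simp add: G_def)
    with support_x[OF z(1) j] z show "j \<notin> F" by (auto simp: t_def)
  next
    assume "j \<notin> F"
    then have "support i x \<le> support j x" if "i \<in> D" for i
      using support_x[OF that j] by (simp add: t_def of_bool_def split: if_splits)
    then have "dual_polytope \<subseteq> {h. h x \<le> support j x}"
      unfolding dual_polytope_def by (intro hull_minimal convex_value_le) auto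
    then show "support j \<in> G"
      using j by (auto simp: G_def dual_polytope_def hull_inc)
  qed
  then have "{j \<in> D. support j \<notin> G} = F" using F by auto
  moreover have ne: "G \<noteq> {}" using F support_in_G by blast
  ultimately have "C = {x \<in> span (u ` D). \<forall>f\<in>G. \<forall>h\<in>dual_polytope. h x \<le> f x}"
    using normal_cone_of_face(2)[OF face ne] C by simp
  then show "C \<in> normal_fan (span (u ` D)) dual_polytope"
    unfolding normal_fan_def using face ne by blast
qed

end

section \<open>Divided differences of binary forms\<close>

definition det2 :: "real \<times> real \<Rightarrow> real \<times> real \<Rightarrow> real"
  where "det2 v w = fst v * snd w - snd v * fst w"

lemma det2_swap: "det2 w v = - det2 v w"
  by (simp add: det2_def)

text \<open>The denominator at the node \<open>j\<close> of the homogeneous divided difference with nodes \<open>v j\<close>, \<open>j\<close> in \<open>J\<close>.\<close>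

definition dets_at :: "('i \<Rightarrow> real \<times> real) \<Rightarrow> 'i set \<Rightarrow> 'i \<Rightarrow> real"
  where "dets_at v J j = (\<Prod>l\<in>J - {j}. det2 (v j) (v l))"

lemma dets_at_remove:
  assumes "finite J" "m \<in> J" "j \<in> J" "j \<noteq> m"
  shows "dets_at v J j = det2 (v j) (v m) * dets_at v (J - {m}) j"
proof -
  have "J - {j} - {m} = J - {m} - {j}" by blast
  then show ?thesis
    unfolding dets_at_def using assms by (simp add: prod.remove[of "J - {j}" m])
qed

text \<open>A form divisible by the linear form that vanishes at a node has the same divided difference as the
  quotient form on the remaining nodes.\<close>

lemma divided_difference_drop:
  assumes J: "finite J" "m \<in> J" and nz: "\<And>j l. j \<in> J \<Longrightarrow> l \<in> J \<Longrightarrow> j \<noteq> l \<Longrightarrow> det2 (v j) (v l) \<noteq> 0"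
  shows "(\<Sum>j\<in>J. det2 (v j) (v m) * h j / dets_at v J j) = (\<Sum>j\<in>J - {m}. h j / dets_at v (J - {m}) j)"
proof -
  have "(\<Sum>j\<in>J. det2 (v j) (v m) * h j / dets_at v J j)
      = (\<Sum>j\<in>J - {m}. det2 (v j) (v m) * h j / dets_at v J j)"
    using J by (simp add: sum.remove[of J m] det2_def)
  also have "\<dots> = (\<Sum>j\<in>J - {m}. h j / dets_at v (J - {m}) j)"
    using J nz[of _ m] by (intro sum.cong) (auto simp: dets_at_remove)
  finally show ?thesis .
qed

lemma linear_form_in_det_basis:
  assumes "det2 v1 v2 \<noteq> 0"
  obtains x y where "\<And>w. a * fst w + b * snd w = x * det2 w v1 + y * det2 w v2"
proof
  fix w
  let ?D = "det2 v1 v2"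
  have "(a * fst w + b * snd w) * ?D
      = - (a * fst v2 + b * snd v2) * det2 w v1 + (a * fst v1 + b * snd v1) * det2 w v2"
    by (simp add: det2_def algebra_simps)
  with assms show "a * fst w + b * snd w
      = - (a * fst v2 + b * snd v2) / ?D * det2 w v1 + (a * fst v1 + b * snd v1) / ?D * det2 w v2"
    by (simp add: divide_simps)
qed

text \<open>Divided differences annihilate the forms of degree two less than the number of nodes. By induction
  on the degree: one linear factor is a combination of the two forms vanishing at two chosen nodes,
  and each of the resulting terms loses a node and a factor. The base case is the antisymmetry of
  the determinant. Products of linear forms suffice, since monomials are among them.\<close>

lemma divided_difference_vanishes:
  assumes "finite J" "card J = r + 2"
    and nz: "\<And>j l. j \<in> J \<Longrightarrow> l \<in> J \<Longrightarrow> j \<noteq> l \<Longrightarrow> det2 (v j) (v l) \<noteq> 0"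
  shows "(\<Sum>j\<in>J. (\<Prod>i<r. a i * fst (v j) + b i * snd (v j)) / dets_at v J j) = 0"
  using assms
proof (induction r arbitrary: J)
  case 0
  then have "card J = 2" by simp
  then obtain m m' where J: "J = {m, m'}" "m \<noteq> m'" by (auto simp: card_2_iff)
  then have "J - {m} = {m'}" "J - {m'} = {m}" by auto
  with J show ?case by (simp add: dets_at_def det2_swap[of "v m'" "v m"])
next
  case (Suc r)
  let ?h = "\<lambda>j. \<Prod>i<r. a i * fst (v j) + b i * snd (v j)"
  have "card J \<noteq> 0" "card J \<noteq> 1" using Suc.prems(2) by simp_all
  then obtain m where m: "m \<in> J" by fastforce
  have "J - {m} \<noteq> {}" using Suc.prems(2) card_mono[of "{m}" J] by auto
  then obtain m' where m': "m' \<in> J" "m' \<noteq> m" by blast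
  have dd: "(\<Sum>j\<in>J. det2 (v j) (v l) * ?h j / dets_at v J j) = 0" if l: "l \<in> J" for l
  proof -
    have "(\<Sum>j\<in>J - {l}. ?h j / dets_at v (J - {l}) j) = 0"
      using Suc.prems l by (intro Suc.IH) auto
    then show ?thesis
      using divided_difference_drop[OF Suc.prems(1) l, of v ?h, OF Suc.prems(3)] by simp
  qed
  obtain x y where xy: "\<And>w. a r * fst w + b r * snd w = x * det2 w (v m) + y * det2 w (v m')"
    using linear_form_in_det_basis Suc.prems(3)[OF m m'(1)] m'(2) by metis
  have "(\<Sum>j\<in>J. (\<Prod>i<Suc r. a i * fst (v j) + b i * snd (v j)) / dets_at v J j)
      = (\<Sum>j\<in>J. x * (det2 (v j) (v m) * ?h j / dets_at v J j)
               + y * (det2 (v j) (v m') * ?h j / dets_at v J j))"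
    by (intro sum.cong) (simp_all add: xy algebra_simps add_divide_distrib)
  also have "\<dots> = 0"
    using dd[OF m] dd[OF m'(1)] by (simp only: sum.distrib sum_distrib_left[symmetric] mult_zero_right add_0)
  finally show ?case .
qed

text \<open>Lets a relation among monomials be tested against arbitrary products of linear forms.\<close>

lemma product_of_linear_forms_expand:
  fixes a b :: "'i \<Rightarrow> real"
  assumes "finite S"
  shows "\<exists>\<gamma>. \<forall>w. (\<Prod>l\<in>S. a l * fst w + b l * snd w)
      = (\<Sum>t\<le>card S. \<gamma> t * (snd w ^ t * fst w ^ (card S - t)))"
  using assms
proof (induction S rule: finite_induct)
  case empty
  show ?case by (intro exI[of _ "\<lambda>_. 1"]) simp
next
  case (insert l S)
  let ?r = "card S"
  obtain \<gamma> where \<gamma>: "\<And>w. (\<Prod>l\<in>S. a l * fst w + b l * snd w)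
      = (\<Sum>t\<le>?r. \<gamma> t * (snd w ^ t * fst w ^ (?r - t)))" using insert.IH by blast
  let ?\<delta> = "\<lambda>t. (if t \<le> ?r then a l * \<gamma> t else 0) + (case t of 0 \<Rightarrow> 0 | Suc s \<Rightarrow> b l * \<gamma> s)"
  show ?case
  proof (intro exI[of _ ?\<delta>] allI)
    fix w :: "real \<times> real"
    have A: "a l * fst w * (\<Sum>t\<le>?r. \<gamma> t * (snd w ^ t * fst w ^ (?r - t)))
        = (\<Sum>t\<le>Suc ?r. (if t \<le> ?r then a l * \<gamma> t else 0) * (snd w ^ t * fst w ^ (Suc ?r - t)))"
      by (simp add: sum_distrib_left) (intro sum.cong, auto simp: Suc_diff_le algebra_simps)
    have B: "b l * snd w * (\<Sum>t\<le>?r. \<gamma> t * (snd w ^ t * fst w ^ (?r - t)))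
        = (\<Sum>t\<le>Suc ?r. (case t of 0 \<Rightarrow> 0 | Suc s \<Rightarrow> b l * \<gamma> s) * (snd w ^ t * fst w ^ (Suc ?r - t)))"
      unfolding sum.atMost_Suc_shift by (simp add: sum_distrib_left algebra_simps)
    show "(\<Prod>l\<in>insert l S. a l * fst w + b l * snd w)
        = (\<Sum>t\<le>card (insert l S). ?\<delta> t * (snd w ^ t * fst w ^ (card (insert l S) - t)))"
      by (simp only: prod.insert[OF insert.hyps] card_insert_disjoint[OF insert.hyps]
          \<gamma> distrib_right A B sum.distrib)
  qed
qed

lemma monomial_relation:
  assumes "finite J" "card J = r + 2" "t \<le> r"
    and nz: "\<And>j l. j \<in> J \<Longrightarrow> l \<in> J \<Longrightarrow> j \<noteq> l \<Longrightarrow> det2 (v j) (v l) \<noteq> 0"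
  shows "(\<Sum>j\<in>J. snd (v j) ^ t * fst (v j) ^ (r - t) / dets_at v J j) = 0"
proof -
  have "(\<Prod>i<r. of_bool (t \<le> i) * fst w + of_bool (i < t) * snd w) = snd w ^ t * fst w ^ (r - t)"
    for w :: "real \<times> real"
  proof -
    have "{..<r} = {..<t} \<union> {t..<r}" using assms(3) by auto
    then have "(\<Prod>i<r. of_bool (t \<le> i) * fst w + of_bool (i < t) * snd w)
        = (\<Prod>i<t. of_bool (t \<le> i) * fst w + of_bool (i < t) * snd w)
        * (\<Prod>i=t..<r. of_bool (t \<le> i) * fst w + of_bool (i < t) * snd w)"
      by (simp add: prod.union_disjoint ivl_disj_int)
    also have "(\<Prod>i<t. of_bool (t \<le> i) * fst w + of_bool (i < t) * snd w) = (\<Prod>i<t. snd w)"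
      by (intro prod.cong) auto
    also have "(\<Prod>i=t..<r. of_bool (t \<le> i) * fst w + of_bool (i < t) * snd w) = (\<Prod>i=t..<r. fst w)"
      by (intro prod.cong) auto
    finally show ?thesis by simp
  qed
  then show ?thesis
    using divided_difference_vanishes[of J r v, OF assms(1,2) nz, where a = "\<lambda>i. of_bool (t \<le> i)" and b = "\<lambda>i. of_bool (i < t)"]
    by simp
qed

text \<open>Test the relation against the product of the linear forms that vanish at all nodes but \<open>j\<close> and \<open>m\<close>:
  only these two terms survive, and they give the ratio of \<open>c j\<close> and \<open>c m\<close>.\<close>

lemma monomial_relation_unique:
  assumes J: "finite J" "card J = r + 2"
    and nz: "\<And>j l. j \<in> J \<Longrightarrow> l \<in> J \<Longrightarrow> j \<noteq> l \<Longrightarrow> det2 (v j) (v l) \<noteq> 0"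
    and rel: "\<And>t. t \<le> r \<Longrightarrow> (\<Sum>j\<in>J. c j * (snd (v j) ^ t * fst (v j) ^ (r - t))) = 0"
    and jm: "j \<in> J" "m \<in> J"
  shows "c j * dets_at v J j = c m * dets_at v J m"
proof (cases "j = m")
  case False
  let ?S = "J - {j, m}"
  let ?f = "\<lambda>w. \<Prod>l\<in>?S. det2 w (v l)"
  have card: "card ?S = r" using J jm False by (simp add: card_Diff_subset)
  obtain \<gamma> where \<gamma>: "\<And>w. ?f w = (\<Sum>t\<le>r. \<gamma> t * (snd w ^ t * fst w ^ (r - t)))"
    using product_of_linear_forms_expand[of ?S "\<lambda>l. snd (v l)" "\<lambda>l. - fst (v l)"] J card
    by (auto simp: det2_def algebra_simps)
  have "(\<Sum>i\<in>J. c i * ?f (v i)) = (\<Sum>t\<le>r. \<Sum>i\<in>J. \<gamma> t * (c i * (snd (v i) ^ t * fst (v i) ^ (r - t))))"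
    unfolding \<gamma> by (subst sum.swap) (simp add: sum_distrib_left algebra_simps)
  also have "\<dots> = 0" by (simp add: sum_distrib_left[symmetric] rel)
  finally have "(\<Sum>i\<in>J. c i * ?f (v i)) = 0" .
  moreover have "(\<Sum>i\<in>J. c i * ?f (v i)) = (\<Sum>i\<in>{j, m}. c i * ?f (v i))"
  proof (rule sum.mono_neutral_right)
    show "\<forall>i\<in>J - {j, m}. c i * ?f (v i) = 0"
    proof
      fix i assume "i \<in> J - {j, m}"
      then have "?f (v i) = 0"
        using J by (intro prod_zero bexI[of _ i]) (auto simp: det2_def)
      then show "c i * ?f (v i) = 0" by simp
    qed
  qed (use J jm in auto)
  ultimately have *: "c j * ?f (v j) + c m * ?f (v m) = 0" using False by simp
  have "J - {m} - {j} = ?S" "J - {j} - {m} = ?S" by auto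
  then have "dets_at v J j = det2 (v j) (v m) * ?f (v j)" "dets_at v J m = - (det2 (v j) (v m) * ?f (v m))"
    using dets_at_remove[of J m j v] dets_at_remove[of J j m v] J jm False det2_swap[of "v m" "v j"]
    by (auto simp: dets_at_def)
  then have "c j * dets_at v J j - c m * dets_at v J m
      = det2 (v j) (v m) * (c j * ?f (v j) + c m * ?f (v m))"
    by (simp add: algebra_simps)
  with * show ?thesis by simp
qed simp

section \<open>Orientations of points in convex position\<close>

text \<open>Twice the signed area of the triangle \<open>q i, q j, q l\<close>.\<close>

definition turn :: "(nat \<Rightarrow> real \<times> real) \<Rightarrow> nat \<Rightarrow> nat \<Rightarrow> nat \<Rightarrow> real"
  where "turn q i j l = det2 (q i - q j) (q i - q l)"

lemma turn_swap: "turn q j i l = - turn q i j l" "turn q i l j = - turn q i j l"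
  and turn_rotate: "turn q j l i = turn q i j l"
  by (simp_all add: turn_def det2_def algebra_simps)

text \<open>The three-term Pluecker relation of the four vectors from \<open>q i\<close> to the other points.\<close>

lemma turn_pluecker:
  "turn q i a c * turn q i b e = turn q i a b * turn q i c e + turn q i a e * turn q i b c"
  by (simp add: turn_def det2_def algebra_simps)

text \<open>An edge of the polygon is exposed, so a linear functional is constant on it and smaller at all other
  vertices. Up to an additive constant, it is a multiple of the orientation with respect to the
  edge; the multiple \<open>s\<close> does not depend on the third point.\<close>

lemma boundary_edge_turn:
  assumes cp: "convex_position n q" and i: "1 \<le> i" "i < n"
  shows "\<exists>s. \<forall>l\<in>{1..n} - {i, Suc i}. 0 < s * turn q i (Suc i) l"
proof -
  let ?C = "convex hull (q ` {1..n})"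
  let ?T = "closed_segment (q i) (q (Suc i))"
  have inj: "inj_on q {1..n}" and ext: "\<And>l. l \<in> {1..n} \<Longrightarrow> q l extreme_point_of ?C"
    using cp unfolding convex_position_def by auto
  have "?T edge_of ?C"
    using cp i unfolding convex_position_def by (auto dest!: bspec[of _ _ i])
  then have "?T exposed_face_of ?C"
    by (simp add: edge_of_def exposed_face_of_polyhedron polytope_imp_polyhedron polytope_convex_hull)
  then obtain a b where ab: "?C \<subseteq> {x. a \<bullet> x \<le> b}" "?T = ?C \<inter> {x. a \<bullet> x = b}"
    unfolding exposed_face_of_def by blast
  have ends: "a \<bullet> q i = b" "a \<bullet> q (Suc i) = b"
    using ab(2) ends_in_segment[of "q i" "q (Suc i)"] by blast+
  define d where "d = q i - q (Suc i)"
  have "q i \<noteq> q (Suc i)" using inj_on_eq_iff[OF inj, of i "Suc i"] i by auto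
  then have d: "d \<noteq> 0" by (simp add: d_def)
  have ad: "fst a * fst d + snd a * snd d = 0"
    using ends by (simp add: d_def inner_prod_def algebra_simps)
  show ?thesis
  proof (intro exI[of _ "snd a * fst d - fst a * snd d"] ballI)
    fix l assume l: "l \<in> {1..n} - {i, Suc i}"
    have mem: "q m \<in> ?C" if "m \<in> {1..n}" for m using that by (simp add: hull_inc)
    have "q l \<noteq> q i" "q l \<noteq> q (Suc i)"
      using inj_on_eq_iff[OF inj, of l i] inj_on_eq_iff[OF inj, of l "Suc i"] i l by auto
    moreover have "q l \<notin> open_segment (q i) (q (Suc i))"
      using ext[of l] l mem[of i] mem[of "Suc i"] i unfolding extreme_point_of_def by auto
    ultimately have "q l \<notin> ?T" by (auto simp: open_segment_def)
    then have "a \<bullet> q l < b" using ab mem[of l] l by force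
    define e where "e = q i - q l"
    have ae: "0 < fst a * fst e + snd a * snd e"
      using \<open>a \<bullet> q l < b\<close> ends by (simp add: e_def inner_prod_def algebra_simps)
    have "(snd a * fst d - fst a * snd d) * turn q i (Suc i) l
        = (fst a * fst e + snd a * snd e) * (fst d ^ 2 + snd d ^ 2)
          - (fst a * fst d + snd a * snd d) * (fst d * fst e + snd d * snd e)"
      unfolding turn_def d_def[symmetric] e_def[symmetric] det2_def
      by (simp add: algebra_simps power2_eq_square)
    moreover have "0 < fst d ^ 2 + snd d ^ 2"
      using d by (simp add: sum_power2_gt_zero_iff prod_eq_iff)
    ultimately show "0 < (snd a * fst d - fst a * snd d) * turn q i (Suc i) l"
      using ad ae by simp
  qed
qed

text \<open>The sign of \<open>boundary_edge_turn\<close> is the same for consecutive edges, as both orient the triple of the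
  three points involved. For general triples, the points \<open>i + 1, i + 2, ...\<close> seen from \<open>q i\<close> lie in one
  open half-plane and each turns positively to its successor, so the order by angle is that of the
  indices; transitivity in the half-plane is the Pluecker relation.\<close>

lemma convex_position_turn:
  assumes cp: "convex_position n q"
  shows "\<exists>s. \<forall>i j l. 1 \<le> i \<longrightarrow> i < j \<longrightarrow> j < l \<longrightarrow> l \<le> n \<longrightarrow> 0 < s * turn q i j l"
proof -
  have "\<forall>i. \<exists>s. 1 \<le> i \<longrightarrow> i < n \<longrightarrow> (\<forall>l\<in>{1..n} - {i, Suc i}. 0 < s * turn q i (Suc i) l)"
    using boundary_edge_turn[OF cp] by blast
  then obtain \<sigma> where \<sigma>: "\<And>i l. 1 \<le> i \<Longrightarrow> i < n \<Longrightarrow> l \<in> {1..n} - {i, Suc i} \<Longrightarrow>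
      0 < \<sigma> i * turn q i (Suc i) l"
    by metis
  define s where "s = \<sigma> 1"
  have edge: "\<forall>l\<in>{1..n} - {i, Suc i}. 0 < s * turn q i (Suc i) l" if "1 \<le> i" "i < n" for i
    using that
  proof (induction i rule: dec_induct)
    case base
    then show ?case using \<sigma>[of 1] by (simp add: s_def)
  next
    case (step i)
    have "0 < s * turn q i (Suc i) (Suc (Suc i))" using step by auto
    moreover have "0 < \<sigma> (Suc i) * turn q i (Suc i) (Suc (Suc i))"
      using \<sigma>[of "Suc i" i] step by (simp add: turn_rotate)
    ultimately have same: "0 < s * \<sigma> (Suc i)" by (auto simp: zero_less_mult_iff)
    show ?case
    proof
      fix l assume "l \<in> {1..n} - {Suc i, Suc (Suc i)}"
      then have "0 < \<sigma> (Suc i) * turn q (Suc i) (Suc (Suc i)) l" using \<sigma>[of "Suc i" l] step by auto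
      with same show "0 < s * turn q (Suc i) (Suc (Suc i)) l" by (auto simp: zero_less_mult_iff)
    qed
  qed
  have "0 < s * turn q i j l" if ij: "1 \<le> i" "i < j" and jl: "Suc j \<le> l" "l \<le> n" for i j l
    using jl
  proof (induction l rule: dec_induct)
    case base
    have "0 < s * turn q j (Suc j) i" using edge[of j] ij base by auto
    then show ?case by (simp add: turn_rotate)
  next
    case (step l)
    show ?case
    proof (cases "j = Suc i")
      case True
      then show ?thesis using edge[of i] ij step by auto
    next
      case False
      let ?t = "\<lambda>x y. s * turn q i x y"
      have "0 < ?t (Suc i) j" "0 < ?t (Suc i) l" "0 < ?t (Suc i) (Suc l)"
        using edge[of i] ij step False by auto
      moreover have "0 < ?t j l" using step by simp
      moreover have "0 < ?t l (Suc l)"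
        using edge[of l] ij step by (simp add: turn_rotate)
      moreover have "?t (Suc i) l * ?t j (Suc l) = ?t (Suc i) j * ?t l (Suc l) + ?t (Suc i) (Suc l) * ?t j l"
        using arg_cong[OF turn_pluecker[of q i "Suc i" l j "Suc l"], of "\<lambda>x. s * s * x"]
        by (simp add: algebra_simps)
      ultimately have "0 < ?t (Suc i) l * ?t j (Suc l)" by (simp add: add_pos_pos)
      with \<open>0 < ?t (Suc i) l\<close> show ?thesis using zero_less_mult_pos by blast
    qed
  qed
  then show ?thesis using Suc_leI by blast
qed

lemma convex_position_turn_nonzero:
  assumes cp: "convex_position n q" and ijl: "i \<in> {1..n}" "j \<in> {1..n}" "l \<in> {1..n}"
    and ne: "i \<noteq> j" "j \<noteq> l" "i \<noteq> l"
  shows "turn q i j l \<noteq> 0"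
proof -
  obtain s where s: "\<And>i j l. 1 \<le> i \<Longrightarrow> i < j \<Longrightarrow> j < l \<Longrightarrow> l \<le> n \<Longrightarrow> 0 < s * turn q i j l"
    using convex_position_turn[OF cp] by blast
  have *: "turn q i j l \<noteq> 0" if "1 \<le> i" "i < j" "j < l" "l \<le> n" for i j l
    using s[OF that] by auto
  have perm: "turn q i l j = - turn q i j l" "turn q j i l = - turn q i j l"
    "turn q l j i = - turn q i j l" "turn q j l i = turn q i j l" "turn q l i j = turn q i j l"
    by (simp_all add: turn_def det2_def algebra_simps)
  consider "i < j" "j < l" | "i < l" "l < j" | "j < i" "i < l" | "j < l" "l < i" | "l < i" "i < j" | "l < j" "j < i"
    using ne by linarith
  then show ?thesis
    using ijl *[of i j l] *[of i l j] *[of j i l] *[of j l i] *[of l i j] *[of l j i] perm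
    by cases simp_all
qed

section \<open>The relation among the rows of the cofactor matrix\<close>

text \<open>The inverse of the coefficient of the edge \<open>e\<close> in the relation among the rows.\<close>

definition edge_turns :: "nat \<Rightarrow> (nat \<Rightarrow> real \<times> real) \<Rightarrow> nat set \<Rightarrow> real"
  where "edge_turns n q e = (\<Prod>l\<in>{1..n} - e. turn q (Min e) (Max e) l)"

text \<open>Exchanging \<open>i\<close> and \<open>j\<close> changes the sign of every factor, and their number is even.\<close>

lemma edge_turns_pair:
  assumes "even n" "i \<in> {1..n}" "j \<in> {1..n}" "i \<noteq> j"
  shows "edge_turns n q {i, j} = (\<Prod>l\<in>{1..n} - {i, j}. turn q i j l)"
proof (cases "i < j")
  case True
  then have "Min {i, j} = i" "Max {i, j} = j" by auto
  then show ?thesis by (simp add: edge_turns_def)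
next
  case False
  then have "Min {i, j} = j" "Max {i, j} = i" using assms by auto
  moreover have "(\<Prod>l\<in>{1..n} - {i, j}. - turn q i j l)
      = (-1) ^ card ({1..n} - {i, j}) * (\<Prod>l\<in>{1..n} - {i, j}. turn q i j l)"
    by (subst prod_constant[symmetric], subst prod.distrib[symmetric]) simp
  moreover have "even (card ({1..n} - {i, j}))" using assms by (simp add: card_Diff_subset)
  ultimately show ?thesis by (simp add: edge_turns_def turn_swap(1)[of q j i])
qed

lemma edge_turns_eq_dets_at:
  assumes "even n" "i \<in> {1..n}" "j \<in> {1..n}" "i \<noteq> j"
  shows "edge_turns n q {i, j} = dets_at (\<lambda>j. q i - q j) ({1..n} - {i}) j"
proof -
  have "{1..n} - {i} - {j} = {1..n} - {i, j}" by blast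
  then show ?thesis by (simp add: edge_turns_pair[OF assms] dets_at_def turn_def)
qed

lemma edge_turns_nonzero:
  assumes "convex_position n q" "even n" "e \<in> edges n"
  shows "edge_turns n q e \<noteq> 0"
proof -
  obtain i j where e: "e = {i, j}" "i \<in> {1..n}" "j \<in> {1..n}" "i \<noteq> j"
    using assms(3) unfolding edges_def by (blast elim: nsets2_E)
  then show ?thesis
    using convex_position_turn_nonzero[OF assms(1)] assms(2) by (auto simp: edge_turns_pair)
qed

text \<open>With \<open>j = i + k + 1\<close>, the orientation of \<open>(i, j, l)\<close> has one sign for the \<open>k\<close> indices \<open>l\<close> strictly between
  \<open>i\<close> and \<open>j\<close> and the opposite sign for the \<open>k\<close> others. Whether \<open>q\<close> runs clockwise or not only changes
  the sign of an even number of factors.\<close>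

lemma edge_turns_diameter:
  assumes cp: "convex_position (2 * k + 2) q" and i: "1 \<le> i" "i \<le> k + 1"
  shows "0 < (-1) ^ k * edge_turns (2 * k + 2) q {i, i + k + 1}"
proof -
  let ?n = "2 * k + 2" and ?j = "i + k + 1"
  obtain s where s: "\<And>i j l. 1 \<le> i \<Longrightarrow> i < j \<Longrightarrow> j < l \<Longrightarrow> l \<le> ?n \<Longrightarrow> 0 < s * turn q i j l"
    using convex_position_turn[OF cp] by blast
  let ?I = "{i<..<?j}" and ?O = "{1..?n} - {i..?j}"
  have split: "{1..?n} - {i, ?j} = ?I \<union> ?O" "?I \<inter> ?O = {}" using i by auto
  have "card ?O = card {1..?n} - card {i..?j}" using i by (intro card_Diff_subset) auto
  then have card: "card ?I = k" "card ?O = k" by auto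
  have "0 < (\<Prod>l\<in>?I. - (s * turn q i ?j l))"
  proof (rule prod_pos)
    fix l assume "l \<in> ?I"
    then have "0 < s * turn q i l ?j" using s[of i l ?j] i by simp
    also have "turn q i l ?j = - turn q i ?j l" by (rule turn_swap(2))
    finally show "0 < - (s * turn q i ?j l)" by simp
  qed
  moreover have "0 < (\<Prod>l\<in>?O. s * turn q i ?j l)"
  proof (rule prod_pos)
    fix l assume "l \<in> ?O"
    then consider "1 \<le> l" "l < i" | "?j < l" "l \<le> ?n" by fastforce
    then show "0 < s * turn q i ?j l"
      using s[of l i ?j] s[of i ?j l] turn_rotate[symmetric, of q l i ?j] i by cases auto
  qed
  ultimately have "0 < (\<Prod>l\<in>?I. - (s * turn q i ?j l)) * (\<Prod>l\<in>?O. s * turn q i ?j l)"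
    by (rule mult_pos_pos)
  also have "\<dots> = (\<Prod>l\<in>?I. (- s) * turn q i ?j l) * (\<Prod>l\<in>?O. s * turn q i ?j l)" by simp
  also have "\<dots> = (- s) ^ k * s ^ k * ((\<Prod>l\<in>?I. turn q i ?j l) * (\<Prod>l\<in>?O. turn q i ?j l))"
    unfolding prod.distrib prod_constant card by (simp only: ac_simps)
  also have "(\<Prod>l\<in>?I. turn q i ?j l) * (\<Prod>l\<in>?O. turn q i ?j l) = edge_turns ?n q {i, ?j}"
    using split i by (simp add: edge_turns_pair prod.union_disjoint)
  also have "(- s) ^ k * s ^ k = (s ^ k) ^ 2 * (-1) ^ k"
    by (simp add: power_minus[of s] power2_eq_square)
  finally have "0 < (s ^ k) ^ 2 * ((-1) ^ k * edge_turns ?n q {i, ?j})" by (simp only: mult.assoc)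
  then show ?thesis by (simp only: zero_less_mult_iff) (simp add: not_less)
qed

text \<open>The minus sign in the block of the larger vertex turns \<open>q (Min e) - q (Max e)\<close> into its negative,
  because the entries have the odd degree \<open>d - 1\<close>.\<close>

lemma cofactor_matrix_pair:
  assumes "even d" "i \<noteq> j" "t < d"
  shows "cofactor_matrix d q {i, j} (i, t) = snd (q i - q j) ^ t * fst (q i - q j) ^ (d - 1 - t)"
proof (cases "i < j")
  case True
  then have "Min {i, j} = i" "Max {i, j} = j" by auto
  then show ?thesis using assms by (simp add: cofactor_matrix_def cofactor_entry_def)
next
  case False
  then have mm: "Min {i, j} = j" "Max {i, j} = i" using assms by auto
  let ?x = "fst (q i) - fst (q j)" and ?y = "snd (q i) - snd (q j)"
  have "cofactor_matrix d q {i, j} (i, t) = - ((- ?y) ^ t * (- ?x) ^ (d - 1 - t))"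
    using assms mm by (simp add: cofactor_matrix_def cofactor_entry_def)
  also have "\<dots> = - ((-1) ^ t * (-1) ^ (d - 1 - t)) * (?y ^ t * ?x ^ (d - 1 - t))"
    unfolding power_minus[of ?x] power_minus[of ?y] by simp
  also have "(-1) ^ t * (-1) ^ (d - 1 - t) = (-1 :: real)"
    using assms by (simp add: power_add[symmetric])
  finally show ?thesis by simp
qed

lemma cofactor_matrix_outside:
  assumes "e \<in> edges n" "v \<notin> e \<or> d \<le> t"
  shows "cofactor_matrix d q e (v, t) = 0"
proof -
  have "finite e" "e \<noteq> {}" using assms(1) by (auto simp: edges_def nsets_def)
  then have "Min e \<in> e" "Max e \<in> e" by auto
  with assms(2) show ?thesis by (auto simp: cofactor_matrix_def)
qed

lemma finite_edges: "finite (edges n)"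
  by (simp add: edges_def finite_imp_finite_nsets)

lemma sum_scaleR_fun_apply: "(\<Sum>e\<in>E. c e *\<^sub>R M e) x = (\<Sum>e\<in>E. c e * M e x)"
  for M :: "'i \<Rightarrow> 'b \<Rightarrow> real"
  by (induction E rule: infinite_finite_induct) (simp_all add: scaleR_fun_def)

lemma cofactor_relation_iff:
  assumes "even d"
  shows "(\<Sum>e\<in>edges n. c e *\<^sub>R cofactor_matrix d q e) = 0 \<longleftrightarrow>
    (\<forall>i\<in>{1..n}. \<forall>t<d. (\<Sum>j\<in>{1..n} - {i}.
        c {i, j} * (snd (q i - q j) ^ t * fst (q i - q j) ^ (d - 1 - t))) = 0)"
    (is "?X = 0 \<longleftrightarrow> (\<forall>i\<in>_. \<forall>t<d. ?Y i t = 0)")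
proof -
  have inside: "?X (i, t) = ?Y i t" if it: "i \<in> {1..n}" "t < d" for i t
  proof -
    have star: "{e \<in> edges n. i \<in> e} = (\<lambda>j. {i, j}) ` ({1..n} - {i})"
      using it by (auto simp: edges_def nsets_2_eq)
    have inj: "inj_on (\<lambda>j. {i, j}) ({1..n} - {i})"
      by (auto simp: inj_on_def doubleton_eq_iff)
    have "?X (i, t) = (\<Sum>e\<in>{e \<in> edges n. i \<in> e}. c e * cofactor_matrix d q e (i, t))"
      unfolding sum_scaleR_fun_apply
    proof (rule sum.mono_neutral_right)
      show "\<forall>e\<in>edges n - {e \<in> edges n. i \<in> e}. c e * cofactor_matrix d q e (i, t) = 0"
        using cofactor_matrix_outside by fastforce
    qed (auto simp: finite_edges)
    also have "\<dots> = ?Y i t"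
      unfolding star sum.reindex[OF inj]
      using it assms by (intro sum.cong) (auto simp: cofactor_matrix_pair)
    finally show ?thesis .
  qed
  have outside: "?X (i, t) = 0" if "i \<notin> {1..n} \<or> d \<le> t" for i t
    unfolding sum_scaleR_fun_apply
  proof (intro sum.neutral ballI)
    fix e assume e: "e \<in> edges n"
    then have "e \<subseteq> {1..n}" by (simp add: edges_def nsets_def)
    then have "i \<notin> e \<or> d \<le> t" using that by blast
    then show "c e * cofactor_matrix d q e (i, t) = 0" using cofactor_matrix_outside[OF e] by simp
  qed
  have "?X = 0 \<longleftrightarrow> (\<forall>i t. ?X (i, t) = 0)" by (auto simp: fun_eq_iff)
  also have "\<dots> \<longleftrightarrow> (\<forall>i\<in>{1..n}. \<forall>t<d. ?X (i, t) = 0)"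
  proof (intro iffI allI)
    fix i t assume "\<forall>i\<in>{1..n}. \<forall>t<d. ?X (i, t) = 0"
    then show "?X (i, t) = 0" using outside[of i t] by (cases "i \<in> {1..n} \<and> t < d") auto
  qed blast
  also have "\<dots> \<longleftrightarrow> (\<forall>i\<in>{1..n}. \<forall>t<d. ?Y i t = 0)"
    by (intro ball_cong refl all_cong) (simp only: inside)
  finally show ?thesis .
qed

context
  fixes k :: nat and q :: "nat \<Rightarrow> real \<times> real"
  assumes k: "1 \<le> k" and cp: "convex_position (2 * k + 2) q"
begin

lemma star_card: "i \<in> {1..2 * k + 2} \<Longrightarrow> card ({1..2 * k + 2} - {i}) = 2 * k - 1 + 2"
  using k by simp

lemma star_nonzero:
  assumes "i \<in> {1..2 * k + 2}" "j \<in> {1..2 * k + 2} - {i}" "l \<in> {1..2 * k + 2} - {i}" "j \<noteq> l"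
  shows "det2 (q i - q j) (q i - q l) \<noteq> 0"
  using convex_position_turn_nonzero[OF cp, of i j l] assms by (auto simp: turn_def)

lemma cofactor_relation:
  "(\<Sum>e\<in>edges (2 * k + 2). (1 / edge_turns (2 * k + 2) q e) *\<^sub>R cofactor_matrix (2 * k) q e) = 0"
  unfolding cofactor_relation_iff[OF even_mult_iff[THEN iffD2, OF disjI1[OF even_numeral]]]
proof (intro ballI allI impI)
  fix i t assume i: "i \<in> {1..2 * k + 2}" and t: "t < 2 * k"
  have "(\<Sum>j\<in>{1..2 * k + 2} - {i}. snd (q i - q j) ^ t * fst (q i - q j) ^ (2 * k - 1 - t)
      / dets_at (\<lambda>j. q i - q j) ({1..2 * k + 2} - {i}) j) = 0"
    using star_card[OF i] star_nonzero[OF i] t by (intro monomial_relation) auto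
  also have "(\<Sum>j\<in>{1..2 * k + 2} - {i}. snd (q i - q j) ^ t * fst (q i - q j) ^ (2 * k - 1 - t)
      / dets_at (\<lambda>j. q i - q j) ({1..2 * k + 2} - {i}) j)
    = (\<Sum>j\<in>{1..2 * k + 2} - {i}. 1 / edge_turns (2 * k + 2) q {i, j} *
        (snd (q i - q j) ^ t * fst (q i - q j) ^ (2 * k - 1 - t)))"
    using i by (intro sum.cong refl) (subst edge_turns_eq_dets_at, auto)
  finally show "(\<Sum>j\<in>{1..2 * k + 2} - {i}. 1 / edge_turns (2 * k + 2) q {i, j} *
        (snd (q i - q j) ^ t * fst (q i - q j) ^ (2 * k - 1 - t))) = 0" .
qed

text \<open>By uniqueness in the star of a vertex, \<open>c e * edge_turns e\<close> agrees on any two edges with a common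
  vertex, and any two edges are connected by such steps.\<close>

lemma cofactor_relation_unique:
  assumes rel: "(\<Sum>e\<in>edges (2 * k + 2). c e *\<^sub>R cofactor_matrix (2 * k) q e) = 0"
  shows "\<exists>s. \<forall>e\<in>edges (2 * k + 2). c e = s / edge_turns (2 * k + 2) q e"
proof -
  let ?n = "2 * k + 2"
  let ?w = "\<lambda>i j. c {i, j} * edge_turns ?n q {i, j}"
  have "even (2 * k)" by simp
  note rel_star = rel[unfolded cofactor_relation_iff[OF this], rule_format]
  have adj: "?w i j = ?w i m"
    if i: "i \<in> {1..?n}" and jm: "j \<in> {1..?n} - {i}" "m \<in> {1..?n} - {i}" for i j m
  proof -
    have "c {i, j} * dets_at (\<lambda>j. q i - q j) ({1..?n} - {i}) j
        = c {i, m} * dets_at (\<lambda>j. q i - q j) ({1..?n} - {i}) m"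
    proof (rule monomial_relation_unique[where r = "2 * k - 1" and c = "\<lambda>j. c {i, j}"])
      show "(\<Sum>j\<in>{1..?n} - {i}. c {i, j} * (snd (q i - q j) ^ t * fst (q i - q j) ^ (2 * k - 1 - t))) = 0"
        if "t \<le> 2 * k - 1" for t
        by (rule rel_star[OF i]) (use that k in linarith)
    qed (use star_card[OF i] star_nonzero[OF i] jm in auto)
    moreover have "edge_turns ?n q {i, l} = dets_at (\<lambda>j. q i - q j) ({1..?n} - {i}) l"
      if "l \<in> {1..?n} - {i}" for l
      using i that by (intro edge_turns_eq_dets_at) auto
    ultimately show ?thesis using jm by (simp only:)
  qed
  have *: "?w i j = ?w 1 2" if ij: "i \<in> {1..?n}" "j \<in> {1..?n}" "i < j" for i j
  proof -
    have "?w i j = ?w j i" by (simp add: insert_commute)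
    also have "\<dots> = ?w j 1" using ij by (intro adj) auto
    also have "\<dots> = ?w 1 j" by (simp add: insert_commute)
    also have "\<dots> = ?w 1 2" using ij by (intro adj) auto
    finally show ?thesis .
  qed
  have const: "?w i j = ?w 1 2" if "i \<in> {1..?n}" "j \<in> {1..?n}" "i \<noteq> j" for i j
  proof (cases "i < j")
    case False
    with that have "?w j i = ?w 1 2" by (intro *) auto
    then show ?thesis by (simp only: insert_commute)
  qed (use * that in blast)
  have "c e = ?w 1 2 / edge_turns ?n q e" if e: "e \<in> edges ?n" for e
  proof -
    obtain i j where "e = {i, j}" "i \<in> {1..?n}" "j \<in> {1..?n}" "i \<noteq> j"
      using e unfolding edges_def by (blast elim: nsets2_E)
    moreover have "edge_turns ?n q e \<noteq> 0" using edge_turns_nonzero[OF cp _ e] by simp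
    ultimately show ?thesis using const[of i j] by (simp only: eq_divide_eq) simp
  qed
  then show ?thesis by blast
qed

end

section \<open>The complex of diameters\<close>

definition diameters :: "nat \<Rightarrow> nat set set"
  where "diameters k = (\<lambda>i. {i, i + k + 1}) ` {1..k + 1}"

lemma long_edges_eq_diameters:
  "{e \<in> edges (2 * k + 2). k + 1 \<le> edge_length (2 * k + 2) e} = diameters k"
proof (intro equalityI subsetI)
  fix e assume e: "e \<in> {e \<in> edges (2 * k + 2). k + 1 \<le> edge_length (2 * k + 2) e}"
  then obtain x y where "e = {x, y}" "x \<in> {1..2 * k + 2}" "y \<in> {1..2 * k + 2}" "x \<noteq> y"
    unfolding edges_def by (blast elim: nsets2_E)
  then obtain i j where ij: "e = {i, j}" "1 \<le> i" "i < j" "j \<le> 2 * k + 2"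
    by (cases x y rule: linorder_cases) (auto simp: insert_commute)
  then have "Min e = i" "Max e = j" by auto
  with e ij have "j = i + k + 1" by (auto simp: edge_length_def)
  with ij show "e \<in> diameters k" by (auto simp: diameters_def)
next
  fix e assume "e \<in> diameters k"
  then obtain i where "e = {i, i + k + 1}" "1 \<le> i" "i \<le> k + 1" by (auto simp: diameters_def)
  moreover from this have "Min e = i" "Max e = i + k + 1" by auto
  ultimately show "e \<in> {e \<in> edges (2 * k + 2). k + 1 \<le> edge_length (2 * k + 2) e}"
    by (auto simp: edge_length_def edges_def)
qed

lemma card_diameters: "card (diameters k) = k + 1"
proof -
  have "inj_on (\<lambda>i. {i, i + k + 1}) {1..k + 1}" by (auto simp: inj_on_def doubleton_eq_iff)
  then show ?thesis unfolding diameters_def by (simp add: card_image)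
qed

lemma finite_diameters: "finite (diameters k)"
  by (simp add: diameters_def)

lemma diameters_cross: "pairwise cross (diameters k)"
proof -
  have "cross {i, i + k + 1} {a, a + k + 1}" if "i \<in> {1..k + 1}" "a \<in> {1..k + 1}" "i \<noteq> a" for i a
    unfolding cross_def using that
    by (intro exI[of _ i] exI[of _ "i + k + 1"] exI[of _ a] exI[of _ "a + k + 1"]) auto
  then show ?thesis unfolding pairwise_def diameters_def by fastforce
qed

lemma multiassociahedron_eq_simplex_boundary:
  "reduced_multiassociahedron k (2 * k + 2) = {F. F \<subset> diameters k}"
proof -
  have "(\<exists>S\<subseteq>F. card S = k + 1 \<and> pairwise cross S) \<longleftrightarrow> F = diameters k" if "F \<subseteq> diameters k" for F
  proof
    assume "\<exists>S\<subseteq>F. card S = k + 1 \<and> pairwise cross S"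
    then obtain S where "S \<subseteq> F" "card S = card (diameters k)" using card_diameters by auto
    with that have "S = diameters k" using card_subset_eq[OF finite_diameters, of S k] by auto
    with \<open>S \<subseteq> F\<close> that show "F = diameters k" by auto
  next
    assume "F = diameters k"
    then show "\<exists>S\<subseteq>F. card S = k + 1 \<and> pairwise cross S"
      using card_diameters diameters_cross by blast
  qed
  then show ?thesis
    unfolding reduced_multiassociahedron_def long_edges_eq_diameters by blast
qed

section \<open>The quotient by the short edges\<close>

text \<open>The image under \<open>p\<close> of the relation among all rows is the positive relation. A relation among images
  of diameters lifts to a relation among all rows, because its value lies in the span of the short
  edges; uniqueness descends from there.\<close>

lemma quotient_positive_circuit:
  fixes k :: nat and q :: "nat \<Rightarrow> real \<times> real"
    and p :: "(nat \<times> nat \<Rightarrow> real) \<Rightarrow> (nat \<times> nat \<Rightarrow> real)"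
  defines "v \<equiv> cofactor_matrix (2 * k) q"
  assumes k: "1 \<le> k" and cp: "convex_position (2 * k + 2) q"
    and p: "quotient_map_by p (span (v ` edges (2 * k + 2)))
              (span (v ` {e \<in> edges (2 * k + 2). edge_length (2 * k + 2) e \<le> k}))"
  shows "positive_circuit (diameters k) (p \<circ> v) (\<lambda>e. (-1) ^ k / edge_turns (2 * k + 2) q e)"
    and "p ` span (v ` edges (2 * k + 2)) = span ((p \<circ> v) ` diameters k)"
proof -
  let ?n = "2 * k + 2" and ?D = "diameters k" and ?w = "edge_turns (2 * k + 2) q"
  let ?E = "edges ?n"
  define S where "S = {e \<in> ?E. edge_length ?n e \<le> k}"
  have E: "?E = ?D \<union> S" "?D \<inter> S = {}" and fin: "finite S"
    unfolding S_def long_edges_eq_diameters[symmetric] using finite_edges[of ?n] by auto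
  have sumE: "(\<Sum>e\<in>?E. f e) = (\<Sum>e\<in>?D. f e) + (\<Sum>e\<in>S. f e)" for f :: "nat set \<Rightarrow> nat \<times> nat \<Rightarrow> real"
    unfolding E(1) using finite_diameters fin E(2) by (rule sum.union_disjoint)
  have lin: "linear p" and ker: "\<And>w. w \<in> span (v ` ?E) \<Longrightarrow> p w = 0 \<longleftrightarrow> w \<in> span (v ` S)"
    using p unfolding quotient_map_by_def S_def by blast+
  have pS: "p (v e) = 0" if "e \<in> S" for e
    using ker[of "v e"] that E by (auto intro: span_base)
  show "positive_circuit ?D (p \<circ> v) (\<lambda>e. (-1) ^ k / ?w e)"
  proof
    show "finite ?D" by (rule finite_diameters)
    show "?D \<noteq> {}" using card_diameters[of k] by auto
    show "0 < (-1) ^ k / ?w e" if e: "e \<in> ?D" for e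
    proof -
      have "0 < (-1) ^ k * ?w e"
        using e edge_turns_diameter[OF cp] unfolding diameters_def by force
      then show ?thesis by (simp only: zero_less_mult_iff zero_less_divide_iff)
    qed
    have "p (\<Sum>e\<in>?E. (1 / ?w e) *\<^sub>R v e) = (\<Sum>e\<in>?E. (1 / ?w e) *\<^sub>R p (v e))"
      by (simp add: linear_sum[OF lin] linear_cmul[OF lin])
    also have "\<dots> = (\<Sum>e\<in>?D. (1 / ?w e) *\<^sub>R p (v e))"
      unfolding sumE by (simp add: pS)
    finally have "(\<Sum>e\<in>?D. (1 / ?w e) *\<^sub>R p (v e)) = 0"
      using cofactor_relation[OF k cp] linear_0[OF lin] unfolding v_def by simp
    then have "(-1) ^ k *\<^sub>R (\<Sum>e\<in>?D. (1 / ?w e) *\<^sub>R p (v e)) = 0" by simp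
    then show "(\<Sum>e\<in>?D. ((-1) ^ k / ?w e) *\<^sub>R (p \<circ> v) e) = 0"
      by (simp add: scaleR_sum_right)
    fix c assume c: "(\<Sum>e\<in>?D. c e *\<^sub>R (p \<circ> v) e) = 0"
    have "(\<Sum>e\<in>?D. c e *\<^sub>R v e) \<in> span (v ` ?E)"
      using E by (intro span_sum span_scale span_base) auto
    moreover have "p (\<Sum>e\<in>?D. c e *\<^sub>R v e) = 0"
      using c by (simp add: linear_sum[OF lin] linear_cmul[OF lin])
    ultimately have "(\<Sum>e\<in>?D. c e *\<^sub>R v e) \<in> span (v ` S)" using ker by blast
    then obtain b where b: "(\<Sum>e\<in>?D. c e *\<^sub>R v e) = (\<Sum>e\<in>S. b e *\<^sub>R v e)"
      using span_image_sum[OF fin] by blast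
    \<comment> \<open>The short edges cancel the value of the diameters.\<close>
    define c' where "c' e = (if e \<in> ?D then c e else - b e)" for e
    have "(\<Sum>e\<in>?E. c' e *\<^sub>R v e) = (\<Sum>e\<in>?D. c e *\<^sub>R v e) + (\<Sum>e\<in>S. (- b e) *\<^sub>R v e)"
      unfolding sumE using E(2) by (intro arg_cong2[of _ _ _ _ "(+)"] sum.cong) (auto simp: c'_def)
    also have "\<dots> = 0" by (simp add: b sum_negf)
    finally obtain s where s: "\<And>e. e \<in> ?E \<Longrightarrow> c' e = s / ?w e"
      using cofactor_relation_unique[OF k cp] unfolding v_def by blast
    have "c e = (s * (-1) ^ k) * ((-1) ^ k / ?w e)" if "e \<in> ?D" for e
      using s[of e] that E(1) by (simp add: c'_def power_mult_distrib[symmetric])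
    then show "\<exists>s. \<forall>e\<in>?D. c e = s * ((-1) ^ k / ?w e)" by blast
  qed
  have "p ` span (v ` ?E) = span ((p \<circ> v) ` ?E)"
    using linear_span_image[OF lin, of "v ` ?E"] by (simp only: image_comp)
  also have "\<dots> = span ((p \<circ> v) ` ?D)"
  proof (rule span_eq[THEN iffD2], intro conjI)
    show "(p \<circ> v) ` ?E \<subseteq> span ((p \<circ> v) ` ?D)"
      unfolding E(1) image_Un using pS by (auto intro: span_base simp: span_zero)
    show "(p \<circ> v) ` ?D \<subseteq> span ((p \<circ> v) ` ?E)"
      unfolding E(1) by (auto intro: span_base)
  qed
  finally show "p ` span (v ` ?E) = span ((p \<circ> v) ` ?D)" .
qed

theorem corollary4p9:
  fixes k :: nat and q :: "nat \<Rightarrow> real \<times> real"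
  assumes "1 \<le> k"
    and "convex_position (2 * k + 2) q"
  shows "realizes_polytopal_fan k (2 * k + 2) (cofactor_matrix (2 * k) q)"
  unfolding realizes_polytopal_fan_def realizes_complete_fan_def multiassociahedron_eq_simplex_boundary
proof (intro conjI allI impI)
  fix p :: "(nat \<times> nat \<Rightarrow> real) \<Rightarrow> (nat \<times> nat \<Rightarrow> real)"
  let ?v = "cofactor_matrix (2 * k) q"
  assume p: "quotient_map_by p (span (?v ` edges (2 * k + 2)))
              (span (?v ` {e \<in> edges (2 * k + 2). edge_length (2 * k + 2) e \<le> k}))"
  note span = quotient_positive_circuit(2)[OF assms p]
  interpret positive_circuit "diameters k" "p \<circ> ?v" "\<lambda>e. (-1) ^ k / edge_turns (2 * k + 2) q e"
    by (rule quotient_positive_circuit(1)[OF assms p])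
  show "dim (p ` span (?v ` edges (2 * k + 2))) = k * (2 * k + 2 - 2 * k - 1)"
    unfolding span using dim_span_circuit card_diameters by simp
  show "complete_simplicial_fan {F. F \<subset> diameters k} (p \<circ> ?v) (p ` span (?v ` edges (2 * k + 2)))"
    unfolding span by (rule complete_simplicial_fan_boundary)
  show "\<exists>P. polytope P \<and> P \<subseteq> {f. linear f} \<and>
      (\<lambda>F. convex_cone hull ((p \<circ> ?v) ` F)) ` {F. F \<subset> diameters k}
        = normal_fan (p ` span (?v ` edges (2 * k + 2))) P"
    unfolding span
    using polytope_dual dual_polytope_linear boundary_fan_eq_normal_fan by blast
qed

end
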